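(* The ideal-simple Lyubashenko YB-solutions $R_{(f,g)}$ are precisely those with data $(X,f,g)$ classified up to isomorphism by triples $$(m,n,d)\in\mathbb{Z}_{\ge 0}\times\mathbb{Z}_{>0}\times\mathbb{Z}_{>0},\qquad d\le|\mathbb{Z}/m|,$$ (with $\mathbb{Z}/m=\mathbb{Z}$ when $m=0$, in which case $d$ is an arbitrary positive integer) as follows: - $X=\mathbb{Z}/m\times\mathbb{Z}/n$; - $f$ is translation by $(1,0)$, i.e. $f(a,b)=(a+1,b)$; - representing $b\in\mathbb{Z}/n$ by an integer $0\le b\le n-1$, $$g(a,b)=\begin{cases}(a,b+1)&\text{if }0\le b<n-1,\\(a-d,0)&\text{if }b=n-1.\end{cases}$$ That is, each such triple defines an ideal-simple Lyubashenko YB-solution, and every ideal-simple Lyubashenko YB-solution is isomorphic to the one defined by exactly one such triple.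
   Context: For a set $X$ and commuting maps $f,g:X\to X$, the map $R_{(f,g)}:X\times X\to X\times X$, $R_{(f,g)}(x,y)=(f(x),g(y))$, is a solution of the set-theoretic Yang--Baxter equation $R^{12}R^{13}R^{23}=R^{23}R^{13}R^{12}$ on $X^3$; it is called a Lyubashenko (YB-)solution. For a map $R:X\times X\to X\times X$, a non-empty subset $I\subseteq X$ is an ideal of $R$ if $R(I\times X)\subseteq I\times X$ and $R(X\times I)\subseteq X\times I$; $R$ is ideal-simple if $X$ is the only ideal of $R$ (in particular $X\neq\emptyset$). An isomorphism between data $(X,f,g)$ and $(X',f',g')$ is a bijection $\sigma:X\to X'$ with $\sigma f=f'\sigma$ and $\sigma g=g'\sigma$; for non-empty sets, equivalently $(\sigma\times\sigma)\circ R_{(f,g)}=R_{(f',g')}\circ(\sigma\times\sigma)$. *)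

theory Defs
  imports "HOL-Algebra.Elementary_Groups"
begin

text \<open>Maps \<open>X \<times> X \<rightarrow> X \<times> X\<close> are functions on the ambient type, looked at on \<open>X \<times> X\<close> only.\<close>

definition R12 :: "('a \<times> 'a \<Rightarrow> 'a \<times> 'a) \<Rightarrow> 'a \<times> 'a \<times> 'a \<Rightarrow> 'a \<times> 'a \<times> 'a" where
  "R12 R = (\<lambda>(x, y, z). let (u, v) = R (x, y) in (u, v, z))"

definition R13 :: "('a \<times> 'a \<Rightarrow> 'a \<times> 'a) \<Rightarrow> 'a \<times> 'a \<times> 'a \<Rightarrow> 'a \<times> 'a \<times> 'a" where
  "R13 R = (\<lambda>(x, y, z). let (u, w) = R (x, z) in (u, y, w))"

definition R23 :: "('a \<times> 'a \<Rightarrow> 'a \<times> 'a) \<Rightarrow> 'a \<times> 'a \<times> 'a \<Rightarrow> 'a \<times> 'a \<times> 'a" where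
  "R23 R = (\<lambda>(x, y, z). let (v, w) = R (y, z) in (x, v, w))"

definition yb_solution :: "'a set \<Rightarrow> ('a \<times> 'a \<Rightarrow> 'a \<times> 'a) \<Rightarrow> bool" where
  "yb_solution X R \<longleftrightarrow>
     R \<in> X \<times> X \<rightarrow> X \<times> X \<and>
     (\<forall>t \<in> X \<times> X \<times> X. (R12 R \<circ> R13 R \<circ> R23 R) t = (R23 R \<circ> R13 R \<circ> R12 R) t)"

definition lyubashenko_map :: "('a \<Rightarrow> 'a) \<Rightarrow> ('a \<Rightarrow> 'a) \<Rightarrow> 'a \<times> 'a \<Rightarrow> 'a \<times> 'a" where
  "lyubashenko_map f g = (\<lambda>(x, y). (f x, g y))"

text \<open>The Yang--Baxter clause follows from the other three; see the lemma below.\<close>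

definition lyubashenko_solution :: "'a set \<Rightarrow> ('a \<Rightarrow> 'a) \<Rightarrow> ('a \<Rightarrow> 'a) \<Rightarrow> bool" where
  "lyubashenko_solution X f g \<longleftrightarrow>
     f \<in> X \<rightarrow> X \<and> g \<in> X \<rightarrow> X \<and> (\<forall>x \<in> X. f (g x) = g (f x)) \<and>
     yb_solution X (lyubashenko_map f g)"

lemma lyubashenko_solution_iff:
  "lyubashenko_solution X f g \<longleftrightarrow>
     f \<in> X \<rightarrow> X \<and> g \<in> X \<rightarrow> X \<and> (\<forall>x \<in> X. f (g x) = g (f x))"
  by (auto simp: lyubashenko_solution_def yb_solution_def lyubashenko_map_def
      R12_def R13_def R23_def)

definition yb_ideal :: "'a set \<Rightarrow> ('a \<times> 'a \<Rightarrow> 'a \<times> 'a) \<Rightarrow> 'a set \<Rightarrow> bool" where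
  "yb_ideal X R I \<longleftrightarrow>
     I \<noteq> {} \<and> I \<subseteq> X \<and> R ` (I \<times> X) \<subseteq> I \<times> X \<and> R ` (X \<times> I) \<subseteq> X \<times> I"

text \<open>The equivalence makes \<open>X\<close> itself an ideal, so \<open>X\<close> is non-empty.\<close>

definition ideal_simple :: "'a set \<Rightarrow> ('a \<times> 'a \<Rightarrow> 'a \<times> 'a) \<Rightarrow> bool" where
  "ideal_simple X R \<longleftrightarrow> (\<forall>I. yb_ideal X R I \<longleftrightarrow> I = X)"

definition data_isomorphic ::
  "'a set \<Rightarrow> ('a \<Rightarrow> 'a) \<Rightarrow> ('a \<Rightarrow> 'a) \<Rightarrow> 'b set \<Rightarrow> ('b \<Rightarrow> 'b) \<Rightarrow> ('b \<Rightarrow> 'b) \<Rightarrow> bool" where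
  "data_isomorphic X f g X' f' g' \<longleftrightarrow>
     (\<exists>\<sigma>. bij_betw \<sigma> X X' \<and> (\<forall>x \<in> X. \<sigma> (f x) = f' (\<sigma> x) \<and> \<sigma> (g x) = g' (\<sigma> x)))"

text \<open>
  \<open>integer_mod_group m\<close> is the additive group \<open>\<int>/m\<close>, with carrier \<open>{0..<m}\<close> for \<open>m > 0\<close> and
  the group of all integers for \<open>m = 0\<close>. The class of an integer \<open>k\<close> is \<open>k mod int m\<close>; for
  \<open>m = 0\<close> this is \<open>k\<close>. Since \<open>order\<close> is \<open>0\<close> for an infinite group, the bound
  \<open>d \<le> |\<int>/m|\<close> has to exclude \<open>m = 0\<close> explicitly.
\<close>

definition triples :: "(nat \<times> nat \<times> nat) set" where
  "triples = {(m, n, d). n > 0 \<and> d > 0 \<and> (m \<noteq> 0 \<longrightarrow> d \<le> order (integer_mod_group m))}"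

definition std_set :: "nat \<Rightarrow> nat \<Rightarrow> (int \<times> int) set" where
  "std_set m n = carrier (integer_mod_group m) \<times> carrier (integer_mod_group n)"

definition std_f :: "nat \<Rightarrow> int \<times> int \<Rightarrow> int \<times> int" where
  "std_f m = (\<lambda>(a, b). (a \<otimes>\<^bsub>integer_mod_group m\<^esub> (1 mod int m), b))"

definition std_g :: "nat \<Rightarrow> nat \<Rightarrow> nat \<Rightarrow> int \<times> int \<Rightarrow> int \<times> int" where
  "std_g m n d = (\<lambda>(a, b).
     if b < int n - 1 then (a, b + 1)
     else (a \<otimes>\<^bsub>integer_mod_group m\<^esub> inv\<^bsub>integer_mod_group m\<^esub> (int d mod int m), 0))"

end

theory Submission
  imports Defs
begin

text \<open>
  Ideals of \<open>R\<^bsub>(f,g)\<^esub>\<close> are the non-empty subsets stable under \<open>f\<close> and \<open>g\<close>, so ideal-simplicity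
  says that the monoid \<open>\<nat>\<^sup>2\<close>, acting through \<open>f\<close> and \<open>g\<close>, is transitive from every point. Then
  \<open>f\<close> and \<open>g\<close> are invertible, \<open>X\<close> is a homogeneous space of \<open>\<int>\<^sup>2\<close>, and it is determined by the
  stabilizer \<open>H \<subseteq> \<int>\<^sup>2\<close>. The subgroups that occur are those containing some \<open>(p, q)\<close> with
  \<open>p > 0\<close>, \<open>q \<ge> 0\<close> and some \<open>(r, s)\<close> with \<open>r \<ge> 0\<close>, \<open>s > 0\<close>; each has a unique Hermite normal
  form generated by \<open>(m, 0)\<close> and \<open>(d, n)\<close>, and the first condition forces \<open>d > 0\<close> when \<open>m = 0\<close>.
\<close>

section \<open>Commuting maps, their monoid action and ideals\<close>

definition act :: "('a \<Rightarrow> 'a) \<Rightarrow> ('a \<Rightarrow> 'a) \<Rightarrow> nat \<Rightarrow> nat \<Rightarrow> 'a \<Rightarrow> 'a" where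
  "act f g i j x = (f ^^ i) ((g ^^ j) x)"

lemma act_0_0 [simp]: "act f g 0 0 x = x"
  by (simp add: act_def)

text \<open>The factor \<open>X\<close> of either product is preserved by assumption. A non-empty
  \<open>I\<close> makes \<open>X\<close> non-empty, so the two inclusions yield stability under
  \<open>f\<close> and under \<open>g\<close> separately.\<close>

lemma yb_ideal_lyubashenko_iff:
  assumes "f \<in> X \<rightarrow> X" "g \<in> X \<rightarrow> X"
  shows "yb_ideal X (lyubashenko_map f g) I \<longleftrightarrow>
           I \<noteq> {} \<and> I \<subseteq> X \<and> f \<in> I \<rightarrow> I \<and> g \<in> I \<rightarrow> I"
  using assms unfolding yb_ideal_def lyubashenko_map_def image_subset_iff by auto

locale commuting_pair =
  fixes X :: "'a set" and f g :: "'a \<Rightarrow> 'a"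
  assumes f_closed: "f \<in> X \<rightarrow> X" and g_closed: "g \<in> X \<rightarrow> X"
    and commute: "x \<in> X \<Longrightarrow> f (g x) = g (f x)"
begin

lemma funpow_closed: "x \<in> X \<Longrightarrow> (f ^^ i) x \<in> X" "x \<in> X \<Longrightarrow> (g ^^ i) x \<in> X"
  using f_closed g_closed by (induction i) auto

lemma act_closed: "x \<in> X \<Longrightarrow> act f g i j x \<in> X"
  by (simp add: act_def funpow_closed)

lemma f_act: "f (act f g i j x) = act f g (Suc i) j x"
  by (simp add: act_def)

lemma g_funpow_f: "x \<in> X \<Longrightarrow> g ((f ^^ i) x) = (f ^^ i) (g x)"
  by (induction i) (simp_all add: commute[symmetric] funpow_closed)

lemma g_act: "x \<in> X \<Longrightarrow> g (act f g i j x) = act f g i (Suc j) x"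
  by (simp add: act_def g_funpow_f funpow_closed)

lemma act_act: "x \<in> X \<Longrightarrow> act f g i j (act f g k l x) = act f g (i + k) (j + l) x"
proof -
  assume x: "x \<in> X"
  have "(g ^^ j) (act f g k l x) = act f g k (j + l) x"
    by (induction j) (simp_all add: g_act x)
  moreover have "(f ^^ i) (act f g k l' x) = act f g (i + k) l' x" for l'
    by (simp add: act_def funpow_add)
  ultimately show ?thesis
    by (simp add: act_def)
qed

text \<open>The orbit of \<open>x\<close> under all \<open>act f g i j\<close> is the smallest ideal
  containing \<open>x\<close>. Non-emptiness of \<open>X\<close> corresponds to \<open>X\<close>
  being an ideal.\<close>

lemma ideal_simple_iff_transitive:
  "ideal_simple X (lyubashenko_map f g) \<longleftrightarrow>
     X \<noteq> {} \<and> (\<forall>x\<in>X. \<forall>y\<in>X. \<exists>i j. y = act f g i j x)"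
proof
  assume s: "ideal_simple X (lyubashenko_map f g)"
  have "\<exists>i j. y = act f g i j x" if x: "x \<in> X" and y: "y \<in> X" for x y
  proof -
    let ?O = "{y. \<exists>i j. y = act f g i j x}"
    have "x \<in> ?O"
      by (auto intro!: exI[of _ 0])
    moreover have "?O \<subseteq> X"
      using x by (auto simp: act_closed)
    moreover have "f \<in> ?O \<rightarrow> ?O"
      using f_act by blast
    moreover have "g \<in> ?O \<rightarrow> ?O"
      using g_act[OF x] by blast
    ultimately have "yb_ideal X (lyubashenko_map f g) ?O"
      unfolding yb_ideal_lyubashenko_iff[OF f_closed g_closed] by blast
    then have "?O = X"
      using s by (simp add: ideal_simple_def)
    then show ?thesis
      using y by blast
  qed
  moreover have "X \<noteq> {}"
    using s unfolding ideal_simple_def yb_ideal_def by blast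
  ultimately show "X \<noteq> {} \<and> (\<forall>x\<in>X. \<forall>y\<in>X. \<exists>i j. y = act f g i j x)"
    by blast
next
  assume t: "X \<noteq> {} \<and> (\<forall>x\<in>X. \<forall>y\<in>X. \<exists>i j. y = act f g i j x)"
  show "ideal_simple X (lyubashenko_map f g)"
    unfolding ideal_simple_def yb_ideal_lyubashenko_iff[OF f_closed g_closed]
  proof (intro allI iffI)
    fix I
    assume I: "I \<noteq> {} \<and> I \<subseteq> X \<and> f \<in> I \<rightarrow> I \<and> g \<in> I \<rightarrow> I"
    then obtain x where x: "x \<in> I"
      by blast
    \<comment> \<open>A stable subset is again the domain of a commuting pair, so it contains the
      orbits of its points.\<close>
    interpret I: commuting_pair I f g
    proof
      show "f \<in> I \<rightarrow> I" "g \<in> I \<rightarrow> I"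
        using I by blast+
      show "f (g x) = g (f x)" if "x \<in> I" for x
        using I that by (intro commute) blast
    qed
    have "y \<in> I" if y: "y \<in> X" for y
    proof -
      have "x \<in> X"
        using x I by blast
      then obtain i j where "y = act f g i j x"
        using t y by meson
      then show ?thesis
        using I.act_closed[OF x] by simp
    qed
    then show "I = X"
      using I by (simp add: subset_antisym subsetI)
  next
    fix I
    assume "I = X"
    then show "I \<noteq> {} \<and> I \<subseteq> X \<and> f \<in> I \<rightarrow> I \<and> g \<in> I \<rightarrow> I"
      using t f_closed g_closed by simp
  qed
qed

end

section \<open>Stabilizers of transitive pairs\<close>

text \<open>
  The differences of exponents turn the stabilizer in the monoid \<open>\<nat>\<^sup>2\<close>, which need not
  determine it, into the stabilizer in the group \<open>\<int>\<^sup>2\<close>.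
\<close>

definition stab :: "'a set \<Rightarrow> ('a \<Rightarrow> 'a) \<Rightarrow> ('a \<Rightarrow> 'a) \<Rightarrow> (int \<times> int) set" where
  "stab X f g = {(int i - int i', int j - int j') | i j i' j'.
     \<exists>x\<in>X. act f g i j x = act f g i' j' x}"

locale transitive_pair = commuting_pair +
  assumes nonempty: "X \<noteq> {}"
    and transitive: "\<lbrakk>x \<in> X; y \<in> X\<rbrakk> \<Longrightarrow> \<exists>i j. y = act f g i j x"
begin

text \<open>\<open>y\<close> lies in the orbit of \<open>x\<close> and the actions commute, so a
  coincidence at \<open>x\<close> is carried over to \<open>y\<close>. The choice of the point in
  \<open>stab\<close> is therefore immaterial.\<close>

lemma act_eq_everywhere:
  assumes "x \<in> X" "y \<in> X" "act f g i j x = act f g i' j' x"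
  shows "act f g i j y = act f g i' j' y"
proof -
  obtain k l where y: "y = act f g k l x"
    using transitive assms by blast
  have "act f g i j y = act f g k l (act f g i j x)"
    using assms(1) by (simp add: y act_act add.commute)
  also have "\<dots> = act f g k l (act f g i' j' x)"
    using assms(3) by simp
  also have "\<dots> = act f g i' j' y"
    using assms(1) by (simp add: y act_act add.commute)
  finally show ?thesis .
qed

text \<open>Transitivity leads from \<open>f x\<close> back to \<open>x\<close> at one point, and
  \<open>act_eq_everywhere\<close> spreads this over \<open>X\<close>. The map
  \<open>act f g i j\<close> is then an inverse of \<open>f\<close>.\<close>

lemma period_f: "\<exists>i j. \<forall>x\<in>X. act f g (Suc i) j x = x"
proof -
  obtain x where x: "x \<in> X"
    using nonempty by blast
  obtain i j where "x = act f g i j (act f g 1 0 x)"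
    using transitive act_closed x by meson
  then have "act f g (Suc i) j x = act f g 0 0 x"
    using x by (simp add: act_act)
  from act_eq_everywhere[OF x _ this] show ?thesis
    by auto
qed

lemma period_g: "\<exists>i j. \<forall>x\<in>X. act f g i (Suc j) x = x"
proof -
  obtain x where x: "x \<in> X"
    using nonempty by blast
  obtain i j where "x = act f g i j (act f g 0 1 x)"
    using transitive act_closed x by meson
  then have "act f g i (Suc j) x = act f g 0 0 x"
    using x by (simp add: act_act)
  from act_eq_everywhere[OF x _ this] show ?thesis
    by auto
qed

lemma inj_on_f: "inj_on f X"
proof (rule inj_onI)
  fix x y
  assume xy: "x \<in> X" "y \<in> X" "f x = f y"
  obtain i j where p: "\<forall>x\<in>X. act f g (Suc i) j x = x"
    using period_f by blast
  have "act f g i j (f z) = z" if "z \<in> X" for z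
    using act_act[OF that, of i j 1 0] that p by (simp add: act_def)
  then show "x = y"
    using xy by metis
qed

lemma inj_on_g: "inj_on g X"
proof (rule inj_onI)
  fix x y
  assume xy: "x \<in> X" "y \<in> X" "g x = g y"
  obtain i j where p: "\<forall>x\<in>X. act f g i (Suc j) x = x"
    using period_g by blast
  have "act f g i j (g z) = z" if "z \<in> X" for z
    using act_act[OF that, of i j 0 1] that p by (simp add: act_def)
  then show "x = y"
    using xy by metis
qed

lemma act_cancel:
  assumes "x \<in> X" "y \<in> X" "act f g i j x = act f g i j y"
  shows "x = y"
proof -
  have f: "(f ^^ i) x = (f ^^ i) y \<Longrightarrow> x = y" if "x \<in> X" "y \<in> X" for x y i
    using that by (induction i) (auto dest!: inj_onD[OF inj_on_f] simp: funpow_closed)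
  have g: "(g ^^ i) x = (g ^^ i) y \<Longrightarrow> x = y" if "x \<in> X" "y \<in> X" for x y i
    using that by (induction i) (auto dest!: inj_onD[OF inj_on_g] simp: funpow_closed)
  show ?thesis
    using assms f g funpow_closed unfolding act_def by metis
qed

text \<open>Membership in \<open>stab\<close> may be witnessed by another point and by other
  exponents with the same differences. As with equality of fractions, both sides are multiplied by a
  power from the witness, which is cancelled at the end by injectivity.\<close>

lemma act_eq_iff_stab:
  assumes x: "x \<in> X"
  shows "act f g i j x = act f g i' j' x \<longleftrightarrow> (int i - int i', int j - int j') \<in> stab X f g"
proof
  assume "(int i - int i', int j - int j') \<in> stab X f g"
  then obtain k l k' l' y where y: "y \<in> X" "act f g k l y = act f g k' l' y"
    and d: "int i - int i' = int k - int k'" "int j - int j' = int l - int l'"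
    unfolding stab_def by auto
  from d have s: "k + i' = k' + i" "l + j' = l' + j"
    by linarith+
  have "act f g k' l' (act f g i j x) = act f g (k + i') (l + j') x"
    using x by (simp add: act_act s)
  also have "\<dots> = act f g i' j' (act f g k l x)"
    using x by (simp add: act_act add.commute)
  also have "\<dots> = act f g i' j' (act f g k' l' x)"
    using act_eq_everywhere[OF y(1) x y(2)] by simp
  also have "\<dots> = act f g k' l' (act f g i' j' x)"
    using x by (simp add: act_act add.commute)
  finally show "act f g i j x = act f g i' j' x"
    using act_cancel act_closed x by blast
qed (use x in \<open>unfold stab_def, blast\<close>)

text \<open>Composing one coincidence with the reverse of the other shows, together with
  \<open>zero_in_stab\<close>, that \<open>stab\<close> is a subgroup.\<close>

lemma stab_diff:
  assumes "(a, b) \<in> stab X f g" "(a', b') \<in> stab X f g"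
  shows "(a - a', b - b') \<in> stab X f g"
proof -
  obtain i j k l where ab: "a = int i - int k" "b = int j - int l"
    using assms(1) unfolding stab_def by auto
  obtain i' j' k' l' where ab': "a' = int i' - int k'" "b' = int j' - int l'"
    using assms(2) unfolding stab_def by auto
  obtain x where x: "x \<in> X"
    using nonempty by blast
  have 1: "act f g i j x = act f g k l x" and 2: "act f g i' j' x = act f g k' l' x"
    using assms x by (simp_all add: act_eq_iff_stab ab ab')
  have "act f g (i + k') (j + l') x = act f g k' l' (act f g i j x)"
    using x by (simp add: act_act add.commute)
  also have "\<dots> = act f g k l (act f g k' l' x)"
    using x 1 by (simp add: act_act add.commute)
  also have "\<dots> = act f g (k + i') (l + j') x"
    using x by (simp add: act_act flip: 2)
  finally show ?thesis
    using x by (simp add: act_eq_iff_stab ab ab' algebra_simps)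
qed

lemma zero_in_stab: "(0, 0) \<in> stab X f g"
  using nonempty act_eq_iff_stab[of _ 0 0 0 0] by auto

text \<open>The signs of \<open>p\<close> and \<open>q\<close> are what later forces
  \<open>d > 0\<close> in the case \<open>m = 0\<close>.\<close>

lemma stab_pos_fst: "\<exists>p q. (p, q) \<in> stab X f g \<and> p > 0 \<and> q \<ge> 0"
proof -
  obtain x where x: "x \<in> X"
    using nonempty by blast
  obtain i j where "act f g (Suc i) j x = act f g 0 0 x"
    using period_f x by auto
  then have "(int (Suc i), int j) \<in> stab X f g"
    unfolding act_eq_iff_stab[OF x] by simp
  then show ?thesis
    by (intro exI[of _ "int (Suc i)"] exI[of _ "int j"]) simp
qed

lemma stab_pos_snd: "\<exists>r s. (r, s) \<in> stab X f g \<and> s > 0"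
proof -
  obtain x where x: "x \<in> X"
    using nonempty by blast
  obtain i j where "act f g i (Suc j) x = act f g 0 0 x"
    using period_g x by auto
  then have "(int i, int (Suc j)) \<in> stab X f g"
    unfolding act_eq_iff_stab[OF x] by simp
  then show ?thesis
    by (intro exI[of _ "int i"] exI[of _ "int (Suc j)"]) simp
qed

end

section \<open>Isomorphism classes and stabilizers\<close>

lemma commuting_pair_iff_lyubashenko:
  "commuting_pair X f g \<longleftrightarrow> lyubashenko_solution X f g"
  by (auto simp: commuting_pair_def lyubashenko_solution_iff)

lemma transitive_pair_iff_ideal_simple:
  "transitive_pair X f g \<longleftrightarrow>
     lyubashenko_solution X f g \<and> ideal_simple X (lyubashenko_map f g)"
  using commuting_pair.ideal_simple_iff_transitive[of X f g]
  by (auto simp: transitive_pair_def transitive_pair_axioms_def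
      simp flip: commuting_pair_iff_lyubashenko)

text \<open>An isomorphism \<sigma> carries \<open>act f g i j x\<close> to
  \<open>act f' g' i j (\<sigma> x)\<close> and is injective, so the same coincidences occur at
  \<open>x\<close> and at \<open>\<sigma> x\<close>.\<close>

lemma data_isomorphic_imp_stab_eq:
  assumes "transitive_pair X f g" "transitive_pair Y f' g'" "data_isomorphic X f g Y f' g'"
  shows "stab X f g = stab Y f' g'"
proof -
  interpret X: transitive_pair X f g by fact
  interpret Y: transitive_pair Y f' g' by fact
  obtain \<sigma> where bij: "bij_betw \<sigma> X Y"
    and \<sigma>: "\<And>x. x \<in> X \<Longrightarrow> \<sigma> (f x) = f' (\<sigma> x)" "\<And>x. x \<in> X \<Longrightarrow> \<sigma> (g x) = g' (\<sigma> x)"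
    using assms(3) unfolding data_isomorphic_def by blast
  obtain x where x: "x \<in> X"
    using X.nonempty by blast
  then have y: "\<sigma> x \<in> Y"
    using bij by (auto simp: bij_betw_def)
  have "\<sigma> ((g ^^ j) x) = (g' ^^ j) (\<sigma> x)" for j
    by (induction j) (simp_all add: \<sigma> x X.funpow_closed)
  then have \<sigma>_act: "\<sigma> (act f g i j x) = act f' g' i j (\<sigma> x)" for i j
    unfolding act_def by (induction i) (simp_all add: \<sigma> x X.funpow_closed)
  have "(int i - int i', int j - int j') \<in> stab X f g \<longleftrightarrow>
        (int i - int i', int j - int j') \<in> stab Y f' g'" for i i' j j'
  proof -
    have "act f g i j x = act f g i' j' x \<longleftrightarrow>
          \<sigma> (act f g i j x) = \<sigma> (act f g i' j' x)"
      using bij x X.act_closed by (metis bij_betw_def inj_on_eq_iff)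
    then show ?thesis
      using X.act_eq_iff_stab[OF x] Y.act_eq_iff_stab[OF y] \<sigma>_act by simp
  qed
  \<comment> \<open>Every integer is a difference of naturals, so the equivalence covers all pairs
    of integers.\<close>
  moreover have "\<exists>i i' j j'. ab = (int i - int i', int j - int j')" for ab
    by (metis int_diff_cases surj_pair)
  ultimately show ?thesis
    by (metis subset_antisym subsetI)
qed

text \<open>After base points are fixed, \<sigma> sends \<open>act f g i j x\<close> to
  \<open>act f' g' i j y\<close>. Equality of the stabilizers makes it well defined and injective;
  transitivity makes it total and surjective.\<close>

lemma stab_eq_imp_data_isomorphic:
  assumes "transitive_pair X f g" "transitive_pair Y f' g'" "stab X f g = stab Y f' g'"
  shows "data_isomorphic X f g Y f' g'"
proof -
  interpret X: transitive_pair X f g by fact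
  interpret Y: transitive_pair Y f' g' by fact
  obtain x y where x: "x \<in> X" and y: "y \<in> Y"
    using X.nonempty Y.nonempty by blast
  have eq: "act f g i j x = act f g i' j' x \<longleftrightarrow> act f' g' i j y = act f' g' i' j' y" for i j i' j'
    using X.act_eq_iff_stab[OF x] Y.act_eq_iff_stab[OF y] assms(3) by simp
  have "\<forall>z\<in>X. \<exists>w. \<forall>i j. z = act f g i j x \<longrightarrow> w = act f' g' i j y"
    using eq by metis
  then obtain \<sigma> where "\<And>z i j. \<lbrakk>z \<in> X; z = act f g i j x\<rbrakk> \<Longrightarrow> \<sigma> z = act f' g' i j y"
    by metis
  then have \<sigma>: "\<sigma> (act f g i j x) = act f' g' i j y" for i j
    using X.act_closed x by blast
  have X_eq: "\<exists>i j. z = act f g i j x" if "z \<in> X" for z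
    using X.transitive x that by blast
  have "inj_on \<sigma> X"
    by (rule inj_onI) (metis X_eq \<sigma> eq)
  moreover have "\<sigma> ` X = Y"
  proof
    show "\<sigma> ` X \<subseteq> Y"
      using X_eq \<sigma> Y.act_closed y by (metis image_subsetI)
    show "Y \<subseteq> \<sigma> ` X"
      using Y.transitive y \<sigma> X.act_closed x by (metis imageI subsetI)
  qed
  moreover have "\<sigma> (f z) = f' (\<sigma> z) \<and> \<sigma> (g z) = g' (\<sigma> z)" if "z \<in> X" for z
    using X_eq[OF that] \<sigma> x y by (auto simp: X.f_act X.g_act Y.f_act Y.g_act)
  ultimately show ?thesis
    unfolding data_isomorphic_def bij_betw_def by blast
qed

section \<open>Hermite normal forms of subgroups of pairs of integers\<close>

text \<open>The subgroup of \<open>\<int>\<^sup>2\<close> generated by \<open>(m, 0)\<close> and \<open>(d, n)\<close>.\<close>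

definition hermite_lattice :: "nat \<Rightarrow> nat \<Rightarrow> nat \<Rightarrow> (int \<times> int) set" where
  "hermite_lattice m n d =
     {(a, b). int n dvd b \<and> int m dvd a - int d * (b div int n)}"

lemma order_integer_mod_group: "m > 0 \<Longrightarrow> order (integer_mod_group m) = m"
  by (simp add: order_def carrier_integer_mod_group)

text \<open>Division by the least positive element leaves a remainder in \<open>S\<close>, which
  must be 0. The trivial subgroup gives \<open>m = 0\<close>.\<close>

lemma int_subgroup_principal:
  fixes S :: "int set"
  assumes zero: "0 \<in> S" and diff: "\<And>a b. \<lbrakk>a \<in> S; b \<in> S\<rbrakk> \<Longrightarrow> a - b \<in> S"
  shows "\<exists>m::nat. S = {a. int m dvd a}"
proof -
  have neg: "- a \<in> S" if "a \<in> S" for a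
    using diff[OF zero that] by simp
  have mult_nat: "int k * a \<in> S" if a: "a \<in> S" for a k
  proof (induction k)
    case (Suc k)
    then show ?case
      using diff[OF Suc neg[OF a]] by (simp add: algebra_simps)
  qed (simp add: zero)
  have mult: "k * a \<in> S" if a: "a \<in> S" for a k
    using mult_nat[OF a, of "nat k"] neg[OF mult_nat[OF a, of "nat (- k)"]]
    by (cases "k \<ge> 0") auto
  show ?thesis
  proof (cases "S = {0}")
    case True
    then show ?thesis
      by (intro exI[of _ 0]) auto
  next
    case False
    then obtain a where "a \<in> S" "a \<noteq> 0"
      using zero by auto
    then have ex: "\<exists>k. k > 0 \<and> int k \<in> S"
      using neg by (intro exI[of _ "nat \<bar>a\<bar>"]) (auto simp: abs_if)
    define m where "m = (LEAST k. k > 0 \<and> int k \<in> S)"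
    have m: "m > 0" "int m \<in> S"
      using LeastI_ex[OF ex] unfolding m_def by auto
    have "int m dvd a" if a: "a \<in> S" for a
    proof -
      have r: "a mod int m \<in> S"
        using diff[OF a mult[OF m(2), of "a div int m"]] by (simp add: minus_div_mult_eq_mod)
      have "\<not> nat (a mod int m) < m \<or> nat (a mod int m) = 0"
        using not_less_Least[of "nat (a mod int m)" "\<lambda>k. k > 0 \<and> int k \<in> S"] r m(1)
        by (auto simp flip: m_def)
      then have "a mod int m = 0"
        using m(1) pos_mod_bound[of "int m" a] pos_mod_sign[of "int m" a] by linarith
      then show ?thesis
        by (simp add: dvd_eq_mod_eq_0)
    qed
    moreover have "a \<in> S" if "int m dvd a" for a
      using that mult[OF m(2)] by (metis dvdE mult.commute)
    ultimately show ?thesis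
      by blast
  qed
qed

text \<open>Here \<open>m\<close> generates the intersection of \<open>H\<close> with the first axis
  and \<open>n\<close> its projection to the second, where \<open>s > 0\<close> excludes
  \<open>n = 0\<close>. An element of \<open>H\<close> over \<open>n\<close> has a first coordinate
  unique modulo \<open>m\<close>, and \<open>d\<close> is a suitable representative of it.\<close>

lemma hermite_normal_form:
  fixes H :: "(int \<times> int) set"
  assumes zero: "(0, 0) \<in> H"
    and diff: "\<And>a b a' b'. \<lbrakk>(a, b) \<in> H; (a', b') \<in> H\<rbrakk> \<Longrightarrow> (a - a', b - b') \<in> H"
    and pq: "(p, q) \<in> H" "p > 0" "q \<ge> 0" and rs: "(r, s) \<in> H" "s > 0"
  shows "\<exists>(m, n, d) \<in> triples. H = hermite_lattice m n d"
proof -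
  have neg: "(- a, - b) \<in> H" if "(a, b) \<in> H" for a b
    using diff[OF zero that] by simp
  have add: "(a + a', b + b') \<in> H" if "(a, b) \<in> H" "(a', b') \<in> H" for a b a' b'
    using diff[OF that(1) neg[OF that(2)]] by simp
  have mult_nat: "(int k * a, int k * b) \<in> H" if ab: "(a, b) \<in> H" for a b k
  proof (induction k)
    case (Suc k)
    then show ?case
      using add[OF Suc ab] by (simp add: algebra_simps)
  qed (simp add: zero)
  have mult: "(k * a, k * b) \<in> H" if ab: "(a, b) \<in> H" for a b k
    using mult_nat[OF ab, of "nat k"] neg[OF mult_nat[OF ab, of "nat (- k)"]]
    by (cases "k \<ge> 0") auto
  have "\<exists>m::nat. {a. (a, 0) \<in> H} = {a. int m dvd a}"
    by (rule int_subgroup_principal) (use zero diff in fastforce)+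
  then obtain m :: nat where m: "\<And>a. (a, 0) \<in> H \<longleftrightarrow> int m dvd a"
    by blast
  have "\<exists>n::nat. {b. \<exists>a. (a, b) \<in> H} = {b. int n dvd b}"
    by (rule int_subgroup_principal) (use zero diff in blast)+
  then obtain n :: nat where n: "\<And>b. (\<exists>a. (a, b) \<in> H) \<longleftrightarrow> int n dvd b"
    by blast
  have n_pos: "n > 0"
    using n[of s] rs by (cases "n = 0") auto
  obtain c where c: "(c, int n) \<in> H"
    using n[of "int n"] by auto
  \<comment> \<open>Subtracting the multiple of \<open>(e, int n)\<close> with second coordinate
    \<open>b\<close> moves \<open>(a, b)\<close> to the first axis, where \<open>m\<close> decides
    membership.\<close>
  have H_iff: "(a, b) \<in> H \<longleftrightarrow> int n dvd b \<and> int m dvd a - e * (b div int n)"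
    if e: "(e, int n) \<in> H" for a b e
  proof (cases "int n dvd b")
    case True
    let ?k = "b div int n"
    have k: "(?k * e, b) \<in> H"
      using mult[OF e, of ?k] unfolding dvd_div_mult_self[OF True] .
    have "(a, b) \<in> H \<longleftrightarrow> (a - ?k * e, 0) \<in> H"
    proof
      assume "(a, b) \<in> H"
      from diff[OF this k] show "(a - ?k * e, 0) \<in> H"
        by (simp only: diff_self)
    next
      assume "(a - ?k * e, 0) \<in> H"
      from add[OF this k] show "(a, b) \<in> H"
        by (simp only: diff_add_cancel add_0)
    qed
    then show ?thesis
      using True by (simp add: m mult.commute)
  next
    case False
    then show ?thesis
      using n[of b] by blast
  qed
  show ?thesis
  proof (cases "m = 0")
    case True
    \<comment> \<open>With \<open>m = 0\<close>, \<open>H\<close> consists of the multiples of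
      \<open>(c, int n)\<close>. For \<open>(p, q)\<close> the factor \<open>k\<close> is
      non-negative, so \<open>p > 0\<close> forces \<open>c > 0\<close>.\<close>
    obtain k where k: "q = int n * k"
      using H_iff[OF c] pq by blast
    then have p: "p = c * k"
      using pq H_iff[OF c] True n_pos by simp
    have "k \<ge> 0"
      using k pq n_pos by (simp add: zero_le_mult_iff)
    then have "c > 0"
      using p pq by (simp add: zero_less_mult_iff)
    then have "(0, n, nat c) \<in> triples" "H = hermite_lattice 0 n (nat c)"
      using n_pos H_iff[OF c] True by (auto simp: triples_def hermite_lattice_def)
    then show ?thesis
      by blast
  next
    case False
    \<comment> \<open>The shift by one selects the representative of \<open>c\<close> in
      \<open>{1..int m}\<close> instead of \<open>{0..<int m}\<close>, as \<open>triples\<close>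
      demands.\<close>
    define e where "e = (c - 1) mod int m + 1"
    have e: "0 < e" "e \<le> int m"
      using False pos_mod_bound[of "int m" "c - 1"] pos_mod_sign[of "int m" "c - 1"]
      unfolding e_def by linarith+
    have "int m dvd e - c"
    proof -
      have "e - c = - (int m * ((c - 1) div int m))"
        using mult_div_mod_eq[of "int m" "c - 1"] unfolding e_def by linarith
      then show ?thesis
        by simp
    qed
    then have "(e, int n) \<in> H"
      using add[OF c, of "e - c" 0] m by simp
    from H_iff[OF this] have "(m, n, nat e) \<in> triples" "H = hermite_lattice m n (nat e)"
      using n_pos e False
      by (auto simp: triples_def hermite_lattice_def order_integer_mod_group)
    then show ?thesis
      by blast
  qed
qed

text \<open>Each generator lies in the other lattice, which gives mutual divisibility of
  \<open>m\<close>, \<open>m'\<close> and of \<open>n\<close>, \<open>n'\<close>. Then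
  \<open>d\<close> and \<open>d'\<close> are congruent modulo \<open>m\<close>: equal at once if
  \<open>m = 0\<close>, and otherwise because both lie between 1 and \<open>m\<close>.\<close>

lemma hermite_lattice_inj:
  assumes t: "(m, n, d) \<in> triples" "(m', n', d') \<in> triples"
    and eq: "hermite_lattice m n d = hermite_lattice m' n' d'"
  shows "m = m' \<and> n = n' \<and> d = d'"
proof -
  have n: "n > 0" "n' > 0"
    using t by (auto simp: triples_def)
  have gen1: "(int m, 0) \<in> hermite_lattice m n d" "(int m', 0) \<in> hermite_lattice m' n' d'"
    by (auto simp: hermite_lattice_def)
  have gen2: "(int d, int n) \<in> hermite_lattice m n d" "(int d', int n') \<in> hermite_lattice m' n' d'"
    using n by (auto simp: hermite_lattice_def)
  have m_eq: "m = m'"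
    using gen1[unfolded eq] gen1[folded eq] by (auto simp: hermite_lattice_def intro: dvd_antisym)
  have n_eq: "n = n'"
    using gen2[unfolded eq] gen2[folded eq] by (auto simp: hermite_lattice_def intro: dvd_antisym)
  have "int m dvd int d - int d'"
    using gen2(1)[unfolded eq] n m_eq n_eq by (simp add: hermite_lattice_def)
  moreover have "\<bar>int d - int d'\<bar> < int m" if "m \<noteq> 0"
    using t that m_eq by (auto simp: triples_def order_integer_mod_group)
  ultimately have "int d - int d' = 0"
    using dvd_imp_le_int[of "int d - int d'" "int m"] by (cases "m = 0") auto
  then show ?thesis
    using m_eq n_eq by simp
qed

section \<open>The standard models in translation coordinates\<close>

text \<open>
  The point \<open>f\<^sup>i g\<^sup>j (0, 0)\<close> of the standard model; in these coordinates \<open>f\<close> and \<open>g\<close> are the two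
  unit translations.
\<close>

definition std_pt :: "nat \<Rightarrow> nat \<Rightarrow> nat \<Rightarrow> int \<Rightarrow> int \<Rightarrow> int \<times> int" where
  "std_pt m n d i j = ((i - int d * (j div int n)) mod int m, j mod int n)"

text \<open>As \<open>x mod 0 = x\<close>, this form treats \<open>m = 0\<close> and
  \<open>m > 0\<close> uniformly.\<close>

lemma mem_carrier_integer_mod_group:
  "x \<in> carrier (integer_mod_group m) \<longleftrightarrow> x mod int m = x"
proof (cases "m = 0")
  case False
  then have "0 \<le> x mod int m" "x mod int m < int m"
    by auto
  then show ?thesis
    using False by (metis atLeastLessThan_iff carrier_integer_mod_group mod_pos_pos_trivial)
qed (simp add: carrier_integer_mod_group)

lemma mult_integer_mod_group_eq: "x \<otimes>\<^bsub>integer_mod_group m\<^esub> y = (x + y) mod int m"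
  by (simp add: integer_mod_group_def integer_group_def)

lemma inv_integer_mod_group_mod: "inv\<^bsub>integer_mod_group m\<^esub> (x mod int m) = (- x) mod int m"
proof -
  interpret group "integer_mod_group m"
    by simp
  show ?thesis
    by (rule inv_equality)
      (simp_all add: mem_carrier_integer_mod_group mult_integer_mod_group_eq mod_simps)
qed

lemma std_f_eq: "std_f m (a, b) = ((a + 1) mod int m, b)"
  by (simp add: std_f_def mult_integer_mod_group_eq mod_simps)

lemma std_g_eq:
  "std_g m n d (a, b) = (if b < int n - 1 then (a, b + 1) else ((a - int d) mod int m, 0))"
  by (simp add: std_g_def mult_integer_mod_group_eq inv_integer_mod_group_mod mod_simps)

lemma std_f_pt: "std_f m (std_pt m n d i j) = std_pt m n d (i + 1) j"
  by (simp add: std_pt_def std_f_eq mod_simps algebra_simps)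

text \<open>The last case of \<open>std_g\<close> is a carry: when \<open>j mod int n\<close> wraps
  to 0, \<open>j div int n\<close> grows by one, which accounts for the subtraction of
  \<open>d\<close>.\<close>

lemma std_g_pt:
  assumes "n > 0"
  shows "std_g m n d (std_pt m n d i j) = std_pt m n d i (j + 1)"
proof (cases "j mod int n < int n - 1")
  case True
  have nonneg: "0 \<le> j mod int n"
    using assms by simp
  have "(j + 1) div int n = j div int n \<and> (j + 1) mod int n = j mod int n + 1"
    using True nonneg mult_div_mod_eq[of "int n" j]
    by (intro conjI int_div_pos_eq[where r = "j mod int n + 1"]
          int_mod_pos_eq[where q = "j div int n"]) auto
  then show ?thesis
    using True by (simp add: std_pt_def std_g_eq)
next
  case False
  then have last: "j mod int n = int n - 1"
    using assms pos_mod_bound[of "int n" j] by linarith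
  have "j + 1 = int n * (j div int n + 1)"
    using mult_div_mod_eq[of "int n" j] last by (simp add: algebra_simps)
  then have "(j + 1) div int n = j div int n + 1 \<and> (j + 1) mod int n = 0"
    using assms by simp
  then show ?thesis
    using last by (simp add: std_pt_def std_g_eq mod_simps algebra_simps)
qed

lemma act_std_pt:
  assumes "n > 0"
  shows "act (std_f m) (std_g m n d) k l (std_pt m n d i j) = std_pt m n d (i + int k) (j + int l)"
proof -
  have "(std_g m n d ^^ l) (std_pt m n d i j) = std_pt m n d i (j + int l)"
    by (induction l) (simp_all add: std_g_pt assms algebra_simps)
  moreover have "(std_f m ^^ k) (std_pt m n d i j') = std_pt m n d (i + int k) j'" for j'
    by (induction k) (simp_all add: std_f_pt algebra_simps)
  ultimately show ?thesis
    by (simp add: act_def)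
qed

lemma std_set_eq_range:
  assumes "n > 0"
  shows "std_set m n = {std_pt m n d i j | i j. True}"
proof (intro equalityI subsetI)
  fix x
  assume "x \<in> std_set m n"
  then obtain a b where x: "x = (a, b)" and a: "a mod int m = a" and b: "b mod int n = b"
    by (auto simp: std_set_def mem_carrier_integer_mod_group)
  have "b div int n = 0"
    using mult_div_mod_eq[of "int n" b] b assms by simp
  then have "x = std_pt m n d a b"
    by (simp add: std_pt_def x a b)
  then show "x \<in> {std_pt m n d i j | i j. True}"
    by blast
qed (auto simp: std_set_def std_pt_def mem_carrier_integer_mod_group)

text \<open>If \<open>n\<close> divides \<open>j - j'\<close>, the remainders agree and the
  difference of the quotients is \<open>(j - j') div int n\<close>; equality of the first
  coordinates is then the second condition of the lattice.\<close>

lemma std_pt_eq_iff: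
  "std_pt m n d i j = std_pt m n d i' j' \<longleftrightarrow> (i - i', j - j') \<in> hermite_lattice m n d"
proof (cases "int n dvd j - j'")
  case True
  then have "j mod int n = j' mod int n"
    by (simp add: mod_eq_dvd_iff)
  moreover have "(j - j') div int n = j div int n - j' div int n"
  proof -
    have "j - j' = int n * (j div int n - j' div int n)"
      using \<open>j mod int n = j' mod int n\<close> mult_div_mod_eq[of "int n" j] mult_div_mod_eq[of "int n" j']
      unfolding right_diff_distrib by linarith
    \<comment> \<open>For \<open>n = 0\<close> both sides are 0, since division by 0 yields
      0.\<close>
    then show ?thesis
      by (metis div_by_0 diff_self nonzero_mult_div_cancel_left)
  qed
  ultimately show ?thesis
    using True unfolding std_pt_def hermite_lattice_def
    by (simp add: mod_eq_dvd_iff right_diff_distrib) (simp add: algebra_simps)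
next
  case False
  then show ?thesis
    by (simp add: std_pt_def hermite_lattice_def mod_eq_dvd_iff)
qed

lemma std_transitive_pair:
  assumes "n > 0" "d > 0"
  shows "transitive_pair (std_set m n) (std_f m) (std_g m n d)"
proof
  note S = std_set_eq_range[OF \<open>n > 0\<close>, of m d]
  show "std_f m \<in> std_set m n \<rightarrow> std_set m n"
    unfolding S using std_f_pt by blast
  show "std_g m n d \<in> std_set m n \<rightarrow> std_set m n"
    unfolding S using std_g_pt[OF \<open>n > 0\<close>] by blast
  show "std_f m (std_g m n d x) = std_g m n d (std_f m x)" if "x \<in> std_set m n" for x
    using that unfolding S by (auto simp: std_f_pt std_g_pt[OF \<open>n > 0\<close>])
  show "std_set m n \<noteq> {}"
    unfolding S by blast
  show "\<exists>i j. y = act (std_f m) (std_g m n d) i j x"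
    if "x \<in> std_set m n" "y \<in> std_set m n" for x y
  proof -
    obtain i j i' j' where x: "x = std_pt m n d i j" and y: "y = std_pt m n d i' j'"
      using \<open>x \<in> _\<close> \<open>y \<in> _\<close> unfolding S by blast
    \<comment> \<open>Since \<open>(d, n)\<close> is in the lattice and has positive entries, a large multiple of it makes
      the required translation non-negative.\<close>
    define t where "t = \<bar>i' - i\<bar> + \<bar>j' - j\<bar>"
    have t: "t \<le> int d * t" "t \<le> int n * t"
      using assms by (auto simp: t_def mult_le_cancel_right1)
    define k where "k = nat (i' - i + int d * t)"
    define l where "l = nat (j' - j + int n * t)"
    have kl: "i + int k = i' + int d * t" "j + int l = j' + int n * t"
      using t unfolding k_def l_def t_def by linarith+
    have "act (std_f m) (std_g m n d) k l x = y"
      using assms by (simp add: x y act_std_pt kl std_pt_eq_iff hermite_lattice_def)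
    then show ?thesis
      by blast
  qed
qed

text \<open>Acting on \<open>std_pt m n d 0 0\<close> by exponents \<open>i\<close>,
  \<open>j\<close> gives the point with coordinates \<open>i\<close>, \<open>j\<close>, so
  \<open>std_pt_eq_iff\<close> describes the coincidences there.\<close>

lemma stab_std:
  assumes "n > 0" "d > 0"
  shows "stab (std_set m n) (std_f m) (std_g m n d) = hermite_lattice m n d"
proof -
  interpret transitive_pair "std_set m n" "std_f m" "std_g m n d"
    by (rule std_transitive_pair) fact+
  have x: "std_pt m n d 0 0 \<in> std_set m n"
    unfolding std_set_eq_range[OF \<open>n > 0\<close>, of m d] by blast
  have "(int i - int i', int j - int j') \<in> stab (std_set m n) (std_f m) (std_g m n d) \<longleftrightarrow>
        (int i - int i', int j - int j') \<in> hermite_lattice m n d" for i i' j j'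
    using act_eq_iff_stab[OF x, of i j i' j'] assms by (simp add: act_std_pt std_pt_eq_iff)
  moreover have "\<exists>i i' j j'. ab = (int i - int i', int j - int j')" for ab
    by (metis int_diff_cases surj_pair)
  ultimately show ?thesis
    by (metis subset_antisym subsetI)
qed

section \<open>Classification up to isomorphism by triples\<close>

theorem corollary2p9:
  shows "(\<forall>(m, n, d) \<in> triples.
            lyubashenko_solution (std_set m n) (std_f m) (std_g m n d) \<and>
            ideal_simple (std_set m n) (lyubashenko_map (std_f m) (std_g m n d))) \<and>
         (\<forall>(X :: 'a set) f g.
            lyubashenko_solution X f g \<and> ideal_simple X (lyubashenko_map f g) \<longrightarrow>
            (\<exists>!t. t \<in> triples \<and>
               (case t of (m, n, d) \<Rightarrow>
                  data_isomorphic X f g (std_set m n) (std_f m) (std_g m n d))))"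
proof (intro conjI allI impI)
  have std: "transitive_pair (std_set m n) (std_f m) (std_g m n d)"
    "stab (std_set m n) (std_f m) (std_g m n d) = hermite_lattice m n d"
    if "(m, n, d) \<in> triples" for m n d
    using that std_transitive_pair stab_std by (auto simp: triples_def)
  then show "\<forall>(m, n, d) \<in> triples.
            lyubashenko_solution (std_set m n) (std_f m) (std_g m n d) \<and>
            ideal_simple (std_set m n) (lyubashenko_map (std_f m) (std_g m n d))"
    by (auto simp: transitive_pair_iff_ideal_simple)
  fix X :: "'a set" and f g
  assume "lyubashenko_solution X f g \<and> ideal_simple X (lyubashenko_map f g)"
  then have X: "transitive_pair X f g"
    by (simp add: transitive_pair_iff_ideal_simple)
  then interpret transitive_pair X f g .
  \<comment> \<open>Isomorphism with a standard model becomes an equality of lattices, so existence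
    and uniqueness of the triple are those of the normal form.\<close>
  have iso_iff: "data_isomorphic X f g (std_set m n) (std_f m) (std_g m n d) \<longleftrightarrow>
      stab X f g = hermite_lattice m n d" if "(m, n, d) \<in> triples" for m n d
    using std[OF that] X data_isomorphic_imp_stab_eq stab_eq_imp_data_isomorphic by metis
  obtain p q r s where "(p, q) \<in> stab X f g" "p > 0" "q \<ge> 0" "(r, s) \<in> stab X f g" "s > 0"
    using stab_pos_fst stab_pos_snd by blast
  then obtain m n d where t: "(m, n, d) \<in> triples" "stab X f g = hermite_lattice m n d"
    using hermite_normal_form[OF zero_in_stab stab_diff] by blast
  show "\<exists>!t. t \<in> triples \<and>
               (case t of (m, n, d) \<Rightarrow>
                  data_isomorphic X f g (std_set m n) (std_f m) (std_g m n d))"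
  proof (rule ex1I[of _ "(m, n, d)"])
    show "(m, n, d) \<in> triples \<and> (case (m, n, d) of (m, n, d) \<Rightarrow>
                  data_isomorphic X f g (std_set m n) (std_f m) (std_g m n d))"
      using t iso_iff by simp
  next
    fix t'
    assume t': "t' \<in> triples \<and> (case t' of (m, n, d) \<Rightarrow>
                  data_isomorphic X f g (std_set m n) (std_f m) (std_g m n d))"
    obtain m' n' d' where "t' = (m', n', d')"
      by (cases t')
    then show "t' = (m, n, d)"
      using t t' iso_iff hermite_lattice_inj by auto
  qed
qed

end
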